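(* Let $K$ be a finite field of characteristic $p$ with $[K:\mathbb{F}_p]$ even, and let $d$ be an integer with $\gcd(d,|K|-1)=1$. If $d\equiv p^j\pmod{\sqrt{|K|}-1}$ for some integer $j$, then $W_{K,d}(a)$ does not take exactly three distinct values as $a$ runs through $K^\times$.
   Context: $\psi_K(x)=\exp(2\pi i\,\mathrm{Tr}_{K/\mathbb{F}_p}(x)/p)$ is the canonical additive character of $K$, and for $a\in K$ the Weil sum is $W_{K,d}(a)=\sum_{x\in K}\psi_K(x^d+ax)$. *)

theory Defs
  imports "HOL-Analysis.Analysis" "HOL-Number_Theory.Cong"
begin

definition ext_degree :: "'a::{finite,field} itself \<Rightarrow> nat" where
  "ext_degree T = (THE n. CARD('a) = CHAR('a) ^ n)"

definition abs_trace :: "'a::{finite,field} \<Rightarrow> 'a" where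
  "abs_trace x = (\<Sum>i<ext_degree TYPE('a). x ^ (CHAR('a) ^ i))"

definition trace_nat :: "'a::{finite,field} \<Rightarrow> nat" where
  "trace_nat x = (THE k. k < CHAR('a) \<and> of_nat k = abs_trace x)"

definition add_char :: "'a::{finite,field} \<Rightarrow> complex" where
  "add_char x = exp (2 * of_real pi * \<i> * of_nat (trace_nat x) / of_nat CHAR('a))"

text \<open>Weil sum W_{K,d}(a) = sum_{x in K} psi_K(x^d + a x); x^d via integer power
  (for negative d, 0^d = 0 since inverse 0 = 0).\<close>
definition weil_sum :: "int \<Rightarrow> 'a::{finite,field} \<Rightarrow> complex" where
  "weil_sum d a = (\<Sum>x\<in>UNIV. add_char (x powi d + a * x))"

end

theory Submission
  imports Defs
begin

text \<open>
  Let \<open>q\<^sup>2 = |K|\<close>. Frobenius invariance of the character reduces to \<open>d = 1 + s (q - 1)\<close>. Summing over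
  multiples of \<open>x\<close> by the subfield of order \<open>q\<close> gives \<open>W(a) = q (N(a) - 1)\<close>, where \<open>N(a)\<close> counts the
  \<open>u\<close> on the unit circle \<open>U = {u. u ^ (q + 1) = 1}\<close> whose affine line
  \<open>u^s + u^(1-s) + a + a^q u = 0\<close> passes through \<open>a\<close>. These are \<open>q + 1\<close> lines of the affine plane of
  order \<open>q\<close>, any two meeting in exactly one point; so unless \<open>N\<close> vanishes somewhere, all points with
  \<open>N \<ge> 2\<close> lie on all lines. For \<open>a\<close> in \<open>U\<close> the equation of the line through \<open>-a\<close> factors as
  \<open>(u^s - a) (1 - u^(1-s) / a) = 0\<close>. With \<open>e\<close> and \<open>f\<close> the orders of the kernels of the
  \<open>s\<close>-th and \<open>(1-s)\<close>-th power maps on \<open>U\<close>, this yields \<open>N(-1) = e + f - 1\<close> and, for \<open>a \<noteq> 1\<close>,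
  \<open>N(-a) = e [a \<in> U^s] + f [a \<in> U^(1-s)]\<close>. Hence, besides \<open>0\<close>, the values include
  \<open>e, f, e + f - 1\<close> if \<open>e, f > 1\<close>; and \<open>1, f, f + 1\<close> if \<open>e = 1 < f\<close>; and \<open>1, 2\<close> and some value
  \<open>\<ge> 3\<close> if \<open>e = f = 1\<close>. The degenerate cases \<open>u^(1-s) = 1\<close> or \<open>u^s = 1\<close> on \<open>U\<close> give only two values.
\<close>

subsection \<open>Finite fields\<close>

lemma prime_CHAR_finite_field: "prime CHAR('a::{finite,field})"
  using prime_CHAR_semidom finite_imp_CHAR_pos[where 'a='a] by auto

text \<open>Multiplication by \<open>x\<close> permutes \<open>G\<close>, so the product over
  \<open>G\<close> equals itself times \<open>x ^ card G\<close> and cancels. This serves both for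
  the unit group and for subgroups of the unit circle.\<close>

lemma power_card_mult_closed:
  fixes G :: "'a::field set"
  assumes "finite G" "0 \<notin> G" "\<And>x y. x \<in> G \<Longrightarrow> y \<in> G \<Longrightarrow> x * y \<in> G" and x: "x \<in> G"
  shows "x ^ card G = 1"
proof -
  have inj: "inj_on ((*) x) G" using assms by (auto simp: inj_on_def)
  then have "(*) x ` G = G" using assms by (intro endo_inj_surj) auto
  then have "(\<Prod>y\<in>G. y) = (\<Prod>y\<in>G. x * y)"
    using prod.reindex[OF inj, of "\<lambda>y. y"] by simp
  also have "\<dots> = x ^ card G * (\<Prod>y\<in>G. y)" by (simp add: prod.distrib)
  moreover have "(\<Prod>y\<in>G. y) \<noteq> 0" using assms by (simp add: prod_zero_iff)
  ultimately show ?thesis by simp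
qed

lemma power_card_eq_self:
  fixes x :: "'a::{finite,field}"
  shows "x ^ CARD('a) = x"
proof (cases "x = 0")
  case False
  have 1: "x ^ card (UNIV - {0::'a}) = 1"
    by (rule power_card_mult_closed) (use False in auto)
  have "CARD('a) = Suc (card (UNIV - {0::'a}))"
    by (rule card.remove) auto
  then show ?thesis
    using 1 by (simp only: power_Suc) simp
qed (simp add: power_0_left)

lemma card_finite_field:
  "\<exists>n. CARD('a::{finite,field}) = CHAR('a) ^ n"
proof -
  let ?p = "CHAR('a)"
  \<comment> \<open>The largest additive subgroup of \<open>p\<close>-power order is the whole field.\<close>
  define P where "P H \<longleftrightarrow> 0 \<in> H \<and> (\<forall>x\<in>H. \<forall>y\<in>H. x + y \<in> H) \<and> (\<exists>k. card H = ?p ^ k)"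
    for H :: "'a set"
  have p: "prime ?p" by (rule prime_CHAR_finite_field)
  have "P {0}" unfolding P_def by (auto intro: exI[of _ 0])
  then obtain H where H: "P H" "\<And>H'. P H' \<Longrightarrow> card H' \<le> card H"
    using ex_has_greatest_nat[of P "{0}" card "Suc CARD('a)"]
    by (metis card_mono finite_code le_imp_less_Suc top_greatest)
  have H0: "0 \<in> H" and Hadd: "\<And>x y. x \<in> H \<Longrightarrow> y \<in> H \<Longrightarrow> x + y \<in> H"
    using H(1) by (auto simp: P_def)
  obtain k where k: "card H = ?p ^ k" using H(1) by (auto simp: P_def)
  have Hmult: "of_nat c * x \<in> H" if "x \<in> H" for c :: nat and x
    by (induction c) (auto simp: H0 Hadd that distrib_right)
  have Hdiff: "x - y \<in> H" if "x \<in> H" "y \<in> H" for x y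
  proof -
    have "of_nat (?p - 1) * y = - y"
      using prime_gt_0_nat[OF p] by simp
    then show ?thesis using Hadd[OF that(1) Hmult[OF that(2), of "?p - 1"]] by simp
  qed
  have "H = UNIV"
  proof (rule ccontr)
    assume "H \<noteq> UNIV"
    then obtain y where y: "y \<notin> H" by auto
    \<comment> \<open>The cosets \<open>H + i y\<close> with \<open>i < p\<close> are disjoint and
      form a subgroup of order \<open>p ^ (k + 1)\<close>, against maximality. A collision would put
      \<open>(j - i) y\<close> into \<open>H\<close>, hence \<open>y\<close> itself, since
      \<open>j - i\<close> is invertible modulo \<open>p\<close>.\<close>
    let ?f = "\<lambda>(h, i::nat). h + of_nat i * y"
    let ?H = "?f ` (H \<times> {..<?p})"
    have aux: False if "h + of_nat i * y = h' + of_nat j * y" "h \<in> H" "h' \<in> H" "i < j" "j < ?p"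
      for h h' i j
    proof -
      have "of_nat (j - i) * y = h - h'"
        using that(1,4) by (simp add: algebra_simps)
      then have 1: "of_nat (j - i) * y \<in> H"
        using Hdiff[OF that(2,3)] by simp
      have "\<not> ?p dvd (j - i)" using that by (auto dest: dvd_imp_le)
      then have "coprime (j - i) ?p"
        using p prime_imp_coprime coprime_commute by blast
      then obtain c where c: "[(j - i) * c = 1] (mod ?p)"
        using cong_solve_coprime_nat[of "j - i" ?p] by auto
      then have "of_nat ((j - i) * c) = (of_nat 1 :: 'a)"
        by (simp only: of_nat_eq_iff_cong_CHAR)
      then have "of_nat c * (of_nat (j - i) * y) = y"
        by (metis mult.assoc mult.commute mult_1 of_nat_1 of_nat_mult)
      then show False using y Hmult[OF 1, of c] by metis
    qed
    have inj: "inj_on ?f (H \<times> {..<?p})"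
    proof (rule inj_onI)
      fix v w assume vw: "v \<in> H \<times> {..<?p}" "w \<in> H \<times> {..<?p}" "?f v = ?f w"
      obtain h i h' j where hij: "v = (h, i)" "w = (h', j)" by fastforce
      have e: "h + of_nat i * y = h' + of_nat j * y" using vw hij by simp
      have "i = j"
        using aux[OF e] aux[OF e[symmetric]] vw hij by (cases i j rule: linorder_cases) auto
      then show "v = w" using e hij by simp
    qed
    have card: "card ?H = ?p ^ Suc k"
      by (subst card_image[OF inj]) (simp add: card_cartesian_product k)
    have "P ?H"
      unfolding P_def
    proof (intro conjI ballI)
      show "0 \<in> ?H"
        using H0 prime_gt_0_nat[OF p] by (force intro!: image_eqI[of _ _ "(0, 0)"])
      show "\<exists>k. card ?H = ?p ^ k" using card by blast
      fix x z assume "x \<in> ?H" "z \<in> ?H"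
      then obtain h i h' j where xz: "x = h + of_nat i * y" "z = h' + of_nat j * y"
        and hh: "h \<in> H" "h' \<in> H" by auto
      have "of_nat ((i + j) mod ?p) = (of_nat (i + j) :: 'a)"
        by (simp only: of_nat_eq_iff_cong_CHAR) (simp add: cong_def)
      then have "x + z = ?f (h + h', (i + j) mod ?p)"
        by (simp add: xz algebra_simps)
      then show "x + z \<in> ?H"
        using hh Hadd prime_gt_0_nat[OF p] by (intro image_eqI[of _ ?f "(h + h', (i + j) mod ?p)"]) auto
    qed
    from H(2)[OF this] have "?p ^ Suc k \<le> ?p ^ k"
      by (simp only: card k)
    then show False using prime_gt_1_nat[OF p] by simp
  qed
  then show ?thesis using k by auto
qed

lemma ext_degree_unique:
  assumes "CARD('a::{finite,field}) = CHAR('a) ^ n"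
  shows "ext_degree TYPE('a) = n"
  unfolding ext_degree_def
  using assms prime_gt_1_nat[OF prime_CHAR_finite_field[where 'a='a]]
  by (intro the_equality) auto

lemma card_eq_CHAR_power_ext_degree:
  "CARD('a::{finite,field}) = CHAR('a) ^ ext_degree TYPE('a)"
  using card_finite_field[where 'a='a] ext_degree_unique[where 'a='a] by metis

lemma add_power_CHAR_power:
  fixes x y :: "'a::{finite,field}"
  shows "(x + y) ^ (CHAR('a) ^ k) = x ^ (CHAR('a) ^ k) + y ^ (CHAR('a) ^ k)"
  by (rule freshmans_dream'[OF prime_CHAR_finite_field refl])

subsection \<open>The canonical additive character\<close>

lemma abs_trace_add: "abs_trace (x + y) = abs_trace x + abs_trace y"
  by (simp add: abs_trace_def add_power_CHAR_power sum.distrib)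

lemma ext_degree_pos: "ext_degree TYPE('a::{finite,field}) > 0"
proof (rule ccontr)
  assume "\<not> ?thesis"
  then have "card (UNIV :: 'a set) = 1"
    using card_eq_CHAR_power_ext_degree[where 'a='a] by simp
  moreover have "card {0, 1 :: 'a} \<le> card (UNIV :: 'a set)"
    by (rule card_mono) auto
  ultimately show False by simp
qed

text \<open>Frobenius permutes the conjugates cyclically; the last one wraps around to
  \<open>x\<close>.\<close>

lemma abs_trace_power_CHAR:
  fixes x :: "'a::{finite,field}"
  shows "abs_trace (x ^ CHAR('a)) = abs_trace x"
proof -
  let ?n = "ext_degree TYPE('a)" and ?p = "CHAR('a)"
  have "abs_trace (x ^ ?p) + x ^ (?p ^ 0) = (\<Sum>i<?n. x ^ (?p ^ Suc i)) + x ^ (?p ^ 0)"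
    by (simp add: abs_trace_def flip: power_mult)
  also have "\<dots> = (\<Sum>i<Suc ?n. x ^ (?p ^ i))"
    by (simp only: sum.lessThan_Suc_shift add.commute)
  also have "\<dots> = abs_trace x + x ^ (?p ^ ?n)"
    by (simp add: abs_trace_def)
  also have "x ^ (?p ^ ?n) = x"
    using power_card_eq_self[of x] card_eq_CHAR_power_ext_degree[where 'a='a] by simp
  finally show ?thesis by simp
qed

text \<open>Applied to \<open>x ^ p - x\<close> and to the additive polynomials with exponent
  \<open>q\<close> below. The bound \<open>k \<ge> 2\<close> keeps the leading term apart from the
  linear part.\<close>

lemma card_roots_trinomial_le:
  fixes a b c :: "'a::{comm_ring_1,ring_no_zero_divisors}"
  assumes "a \<noteq> 0" "k \<ge> 2"
  shows "card {x. a * x ^ k + b * x + c = 0} \<le> k"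
proof -
  let ?P = "monom a k + [:c, b:]"
  have "coeff ?P k = a"
    using assms by (cases k) (auto simp: coeff_pCons split: nat.splits)
  then have "?P \<noteq> 0" using assms by (metis coeff_0)
  moreover have "degree ?P \<le> k"
    using assms by (intro degree_add_le) (auto simp: degree_monom_le intro: order_trans[OF degree_pCons_le])
  ultimately have "card {x. poly ?P x = 0} \<le> k"
    using card_poly_roots_bound order_trans by blast
  then show ?thesis
    by (simp add: poly_monom algebra_simps)
qed

lemma card_roots_of_unity_le:
  assumes "k > 0"
  shows "card {x::'a::{comm_ring_1,ring_no_zero_divisors}. x ^ k = 1} \<le> k"
proof -
  let ?P = "monom (1::'a) k - 1"
  have "coeff ?P k = 1"
    using assms by simp
  then have "?P \<noteq> 0" by (metis coeff_0 zero_neq_one)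
  moreover have "degree ?P \<le> k"
    by (intro degree_diff_le) (auto simp: degree_monom_le)
  ultimately have "card {x. poly ?P x = 0} \<le> k"
    using card_poly_roots_bound order_trans by blast
  then show ?thesis
    by (simp add: poly_monom)
qed

text \<open>The \<open>p\<close> multiples of 1 are roots of \<open>x ^ p - x\<close>, which has no
  room for others.\<close>

lemma power_CHAR_eq_self_iff:
  fixes x :: "'a::{finite,field}"
  shows "x ^ CHAR('a) = x \<longleftrightarrow> (\<exists>k<CHAR('a). x = of_nat k)"
proof -
  let ?p = "CHAR('a)" and ?A = "of_nat ` {..<CHAR('a)} :: 'a set" and ?B = "{x::'a. x ^ CHAR('a) = x}"
  have p: "prime ?p" by (rule prime_CHAR_finite_field)
  have fixed: "(of_nat k :: 'a) ^ ?p = of_nat k" for k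
    by (induction k) (simp_all add: freshmans_dream[OF p refl] zero_power[OF prime_gt_0_nat[OF p]])
  have "card ?A = ?p"
    by (subst card_image) (auto simp: inj_on_def of_nat_eq_iff_cong_CHAR cong_less_modulus_unique_nat)
  moreover have "card ?B \<le> ?p"
    using card_roots_trinomial_le[of "1::'a" ?p "-1" 0] prime_ge_2_nat[OF p] by simp
  moreover have "?A \<subseteq> ?B" using fixed by auto
  ultimately have "?A = ?B" by (metis card_seteq finite)
  then show ?thesis by auto
qed

text \<open>The trace is fixed by Frobenius, so it lies in the prime field; this makes the
  description in \<open>trace_nat\<close> well defined.\<close>

lemma trace_nat_less: "trace_nat (x::'a::{finite,field}) < CHAR('a)"
  and of_nat_trace_nat: "of_nat (trace_nat x) = abs_trace x"
proof -
  have "abs_trace x ^ CHAR('a) = abs_trace (x ^ CHAR('a))"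
    by (simp add: abs_trace_def freshmans_dream_sum[OF prime_CHAR_finite_field refl]
        mult.commute flip: power_mult)
  then obtain k where k: "k < CHAR('a)" "of_nat k = abs_trace x"
    by (auto simp: abs_trace_power_CHAR power_CHAR_eq_self_iff)
  have "\<exists>!k. k < CHAR('a) \<and> of_nat k = abs_trace x"
  proof (rule ex1I[of _ k])
    fix l assume "l < CHAR('a) \<and> of_nat l = abs_trace x"
    then have "of_nat l = (of_nat k :: 'a)" "l < CHAR('a)" using k by auto
    then show "l = k"
      using k(1) by (simp add: of_nat_eq_iff_cong_CHAR cong_less_modulus_unique_nat)
  qed (use k in auto)
  from theI'[OF this] show "trace_nat x < CHAR('a)" "of_nat (trace_nat x) = abs_trace x"
    unfolding trace_nat_def by auto
qed

lemma add_char_add: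
  fixes x y :: "'a::{finite,field}"
  shows "add_char (x + y) = add_char x * add_char y"
proof -
  let ?p = "CHAR('a)"
  define z :: complex where "z = exp (2 * of_real pi * \<i> / of_nat ?p)"
  have p: "?p > 0" using prime_gt_0_nat prime_CHAR_finite_field by blast
  have char: "add_char w = z ^ trace_nat w" for w :: 'a
    by (simp add: add_char_def z_def exp_of_nat_mult[symmetric] mult_ac)
  have "z ^ ?p = 1"
    using p by (simp add: z_def exp_of_nat_mult[symmetric])
  then have red: "z ^ k = z ^ (k mod ?p)" for k
    by (metis mult_1 mult_div_mod_eq power_add power_mult power_one)
  have "[trace_nat (x + y) = trace_nat x + trace_nat y] (mod ?p)"
    by (simp add: of_nat_trace_nat abs_trace_add flip: of_nat_eq_iff_cong_CHAR[where 'a='a])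
  then have "z ^ trace_nat (x + y) = z ^ (trace_nat x + trace_nat y)"
    using red by (metis cong_def)
  then show ?thesis by (simp add: char power_add)
qed

lemma add_char_0: "add_char (0::'a::{finite,field}) = 1"
proof -
  have "add_char (0::'a) \<noteq> 0" by (simp add: add_char_def)
  then show ?thesis using add_char_add[of "0::'a" 0] by simp
qed

lemma add_char_eq_1_iff: "add_char x = 1 \<longleftrightarrow> abs_trace x = 0"
proof
  let ?p = "CHAR('a)" and ?t = "trace_nat x"
  have p: "?p > 0" using prime_gt_0_nat prime_CHAR_finite_field by blast
  assume "add_char x = 1"
  then obtain n :: int where "2 * pi * real ?t / real ?p = of_int (2 * n) * pi"
    by (auto simp: add_char_def exp_eq_1)
  then have "real ?t = of_int n * real ?p"
    using p by (simp add: field_simps)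
  then have "real_of_int (int ?t) = real_of_int (n * int ?p)" by simp
  then have "int ?t = n * int ?p" by (simp only: of_int_eq_iff)
  then have "?p dvd ?t"
    by (metis dvd_triv_right int_dvd_int_iff)
  then have "?t = 0"
    using trace_nat_less[of x] by (auto dest: dvd_imp_le)
  then show "abs_trace x = 0" using of_nat_trace_nat[of x] by simp
next
  assume "abs_trace x = 0"
  then have "CHAR('a) dvd trace_nat x"
    using of_nat_trace_nat[of x] by (simp add: of_nat_eq_0_iff_char_dvd)
  then have "trace_nat x = 0"
    using trace_nat_less[of x] by (auto dest: dvd_imp_le)
  then show "add_char x = 1" by (simp add: add_char_def)
qed

lemma add_char_power_CHAR_power:
  fixes x :: "'a::{finite,field}"
  shows "add_char (x ^ (CHAR('a) ^ k)) = add_char x"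
proof (induction k)
  case (Suc k)
  have "abs_trace (x ^ (CHAR('a) ^ Suc k)) = abs_trace (x ^ (CHAR('a) ^ k))"
    using abs_trace_power_CHAR[of "x ^ (CHAR('a) ^ k)"] by (simp add: mult.commute flip: power_mult)
  then show ?case
    using Suc by (simp add: add_char_def trace_nat_def)
qed simp

text \<open>Translation by \<open>y\<close> permutes \<open>H\<close> and multiplies the sum by
  \<open>add_char y\<close>.\<close>

lemma sum_add_char_subgroup:
  fixes H :: "'a::{finite,field} set"
  assumes add: "\<And>x y. x \<in> H \<Longrightarrow> y \<in> H \<Longrightarrow> x + y \<in> H" and y: "y \<in> H" "add_char y \<noteq> 1"
  shows "(\<Sum>x\<in>H. add_char x) = 0"
proof -
  have "(\<lambda>x. x + y) ` H = H"
    using add y by (intro endo_inj_surj) (auto simp: inj_on_def)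
  then have "(\<Sum>x\<in>H. add_char x) = (\<Sum>x\<in>H. add_char (x + y))"
    by (metis (mono_tags, lifting) add_right_cancel inj_onI sum.reindex_cong)
  also have "\<dots> = (\<Sum>x\<in>H. add_char x) * add_char y"
    by (simp add: add_char_add sum_distrib_right)
  finally show ?thesis using y by simp
qed

subsection \<open>Fields of square order\<close>

lemma card_eq_card_image_times_fibre:
  assumes "finite A" "\<And>b. b \<in> f ` A \<Longrightarrow> card {x \<in> A. f x = b} = k"
  shows "card A = card (f ` A) * k"
proof -
  have "card A = (\<Sum>b\<in>f ` A. card {x \<in> A. f x = b})"
    using assms(1) sum.image_gen[of A "\<lambda>_. 1::nat" f] by simp
  then show ?thesis using assms(2) by simp
qed

lemma card_fibre_mult_hom:
  fixes G :: "'a::field set" and f :: "'a \<Rightarrow> 'b::field"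
  assumes G: "0 \<notin> G" "\<And>x y. x \<in> G \<Longrightarrow> y \<in> G \<Longrightarrow> x * y \<in> G" "\<And>x. x \<in> G \<Longrightarrow> inverse x \<in> G"
    and f: "\<And>x y. x \<in> G \<Longrightarrow> y \<in> G \<Longrightarrow> f (x * y) = f x * f y" "\<And>x. x \<in> G \<Longrightarrow> f x \<noteq> 0"
    and b: "b \<in> f ` G"
  shows "card {x \<in> G. f x = b} = card {x \<in> G. f x = 1}"
proof -
  obtain z where z: "z \<in> G" "b = f z" using b by auto
  have z0: "z \<noteq> 0" using z G by auto
  have "bij_betw (\<lambda>x. x * z) {x \<in> G. f x = 1} {x \<in> G. f x = b}"
  proof (rule bij_betwI[where g = "\<lambda>x. x * inverse z"])
    show "(\<lambda>x. x * inverse z) \<in> {x \<in> G. f x = b} \<rightarrow> {x \<in> G. f x = 1}"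
    proof
      fix x assume x: "x \<in> {x \<in> G. f x = b}"
      then have "f (x * inverse z) * f z = f z"
        using G z z0 f(1)[of "x * inverse z" z] by (simp add: mult.assoc)
      then show "x * inverse z \<in> {x \<in> G. f x = 1}"
        using x z G f(2)[of z] by simp
    qed
  qed (use G z z0 f in auto)
  then show ?thesis by (simp add: bij_betw_same_card)
qed

lemma card_fibre_add_hom:
  fixes f :: "'a::ab_group_add \<Rightarrow> 'b::ab_group_add"
  assumes f: "\<And>x y. f (x + y) = f x + f y" and b: "b \<in> range f"
  shows "card {x. f x = b} = card {x. f x = 0}"
proof -
  obtain z where z: "b = f z" using b by auto
  have "bij_betw (\<lambda>x. x + z) {x. f x = 0} {x. f x = b}"
  proof (rule bij_betwI[where g = "\<lambda>x. x - z"])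
    show "(\<lambda>x. x - z) \<in> {x. f x = b} \<rightarrow> {x. f x = 0}"
    proof
      fix x assume x: "x \<in> {x. f x = b}"
      have "f x = f (x - z) + f z" using f[of "x - z" z] by simp
      then show "x - z \<in> {x. f x = 0}" using x z by simp
    qed
  qed (use z f in auto)
  then show ?thesis by (simp add: bij_betw_same_card)
qed

text \<open>Here \<open>x ^ q\<close> is the conjugation of the field over its subfield
  \<open>F\<close> of order \<open>q\<close>.\<close>

locale square_order_field =
  fixes K :: "'a::{finite,field} itself" and m q :: nat
  assumes card_K: "CARD('a) = q ^ 2" and q_def: "q = CHAR('a) ^ m"
begin

text \<open>The kernel of the relative norm \<open>u ^ (q + 1)\<close>; on it conjugation is
  inversion.\<close>

definition U :: "'a set" where "U = {u. u ^ (q + 1) = 1}"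

definition F :: "'a set" where "F = {y. y ^ q = y}"

lemma power_q_add: "(x + y) ^ q = x ^ q + y ^ q" for x y :: 'a
  by (simp add: q_def add_power_CHAR_power)

lemma power_q_q: "(x ^ q) ^ q = x" for x :: 'a
  using power_card_eq_self[of x] by (simp add: card_K power2_eq_square power_mult)

lemma q_ge_2: "q \<ge> 2"
proof -
  have "card {0, 1 :: 'a} \<le> CARD('a)" by (rule card_mono) auto
  then have "q \<noteq> 0 \<and> q \<noteq> 1" using card_K by (intro conjI notI) auto
  then show ?thesis by simp
qed

lemma power_q_0 [simp]: "(0::'a) ^ q = 0"
  using q_ge_2 by simp

lemma power_q_minus: "(- x) ^ q = - (x ^ q)" for x :: 'a
  using power_q_add[of x "- x"] by (simp add: eq_neg_iff_add_eq_0 add.commute)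

lemma power_q_diff: "(x - y) ^ q = x ^ q - y ^ q" for x y :: 'a
  using power_q_add[of x "- y"] by (simp add: power_q_minus)

lemma U_nonzero: "u \<in> U \<Longrightarrow> u \<noteq> 0"
  by (auto simp: U_def)

lemma one_in_U: "1 \<in> U"
  by (simp add: U_def)

lemma mult_in_U: "u \<in> U \<Longrightarrow> v \<in> U \<Longrightarrow> u * v \<in> U"
  unfolding U_def mem_Collect_eq power_mult_distrib by simp

lemma powi_in_U: "u \<in> U \<Longrightarrow> u powi k \<in> U"
  unfolding U_def mem_Collect_eq power_int_power'
  by (subst mult.commute) (simp only: power_int_mult power_int_of_nat power_int_1_left)

lemma inverse_in_U: "u \<in> U \<Longrightarrow> inverse u \<in> U"
  using powi_in_U[of u "-1"] by (simp add: power_int_minus)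

lemma power_q_U: "u ^ q = inverse u" if "u \<in> U"
  using that U_nonzero[OF that] by (simp add: U_def field_simps)

lemma card_nonzero: "card (UNIV - {0::'a}) = (q + 1) * (q - 1)"
  by (simp add: card_K card_Diff_subset algebra_simps power2_eq_square diff_mult_distrib2)

text \<open>Image and kernel of \<open>x ^ (q - 1)\<close> have orders with product
  \<open>(q + 1) * (q - 1)\<close>, while counting roots bounds them by \<open>q + 1\<close> and
  \<open>q - 1\<close>. Both bounds are therefore attained.\<close>

lemma power_image_eq_U: "(\<lambda>x. x ^ (q - 1)) ` (UNIV - {0}) = U"
  and card_U: "card U = q + 1"
  and card_kernel: "card {x. x \<noteq> 0 \<and> x ^ (q - 1) = (1::'a)} = q - 1"
proof -
  let ?G = "UNIV - {0::'a}" and ?f = "\<lambda>x::'a. x ^ (q - 1)"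
  let ?k = "card {x. x \<noteq> 0 \<and> x ^ (q - 1) = (1::'a)}"
  have 1: "(q + 1) * (q - 1) = card (?f ` ?G) * ?k"
  proof (subst card_nonzero[symmetric], rule card_eq_card_image_times_fibre)
    fix b assume "b \<in> ?f ` ?G"
    then have "card {x \<in> ?G. ?f x = b} = card {x \<in> ?G. ?f x = 1}"
      by (intro card_fibre_mult_hom) (auto simp: power_mult_distrib)
    then show "card {x \<in> ?G. ?f x = b} = ?k" by simp
  qed auto
  have sub: "?f ` ?G \<subseteq> U"
  proof (clarsimp simp: U_def)
    fix x :: 'a assume x: "x \<noteq> 0"
    have "Suc ((q - 1) * Suc q) = q ^ 2"
      using q_ge_2 by (cases q) (auto simp: power2_eq_square)
    then have "x * x ^ ((q - 1) * Suc q) = x"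
      using power_card_eq_self[of x] card_K by (metis power_Suc)
    then have "(x ^ (q - 1)) ^ Suc q = 1"
      using x by (metis mult_cancel_left1 power_mult)
    then show "x ^ (q - Suc 0) * (x ^ (q - Suc 0)) ^ q = 1" by (simp only: power_Suc One_nat_def)
  qed
  have U: "card U \<le> q + 1"
    unfolding U_def by (rule card_roots_of_unity_le) simp
  have im: "card (?f ` ?G) \<le> card U" using sub by (intro card_mono) auto
  have "?k \<le> card {x::'a. x ^ (q - 1) = 1}" by (intro card_mono) auto
  also have "\<dots> \<le> q - 1" by (rule card_roots_of_unity_le) (use q_ge_2 in simp)
  finally have k: "?k \<le> q - 1" .
  have ge: "card (?f ` ?G) \<ge> q + 1"
  proof (rule ccontr)
    assume "\<not> ?thesis"
    then have "card (?f ` ?G) * ?k \<le> q * (q - 1)" using k by (intro mult_le_mono) auto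
    also have "\<dots> < (q + 1) * (q - 1)" using q_ge_2 by simp
    finally show False using 1 by simp
  qed
  then show U': "card U = q + 1" using im U by simp
  show "?f ` ?G = U" using sub ge U' by (metis card_seteq finite)
  have "card (?f ` ?G) = q + 1" using im U ge by simp
  then have "(q + 1) * ?k = (q + 1) * (q - 1)" using 1 by simp
  then show "?k = q - 1" by (simp only: mult_cancel1) simp
qed

lemma F_eq: "F = insert 0 {x. x \<noteq> 0 \<and> x ^ (q - 1) = 1}"
proof -
  have "x ^ q = x * x ^ (q - 1)" for x :: 'a
    using q_ge_2 by (cases q) auto
  then show ?thesis by (auto simp: F_def)
qed

lemma card_F: "card F = q"
proof -
  have "card F = Suc (card {x. x \<noteq> 0 \<and> x ^ (q - 1) = (1::'a)})"
    unfolding F_eq by (rule card_insert_disjoint) auto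
  then show ?thesis using q_ge_2 by (simp only: card_kernel)
qed

lemma ext_degree_eq: "ext_degree TYPE('a) = m + m"
  using card_K by (intro ext_degree_unique) (simp add: q_def power_add power2_eq_square)

text \<open>Transitivity of the trace: the conjugates with indices \<open>i\<close> and
  \<open>m + i\<close> are paired.\<close>

lemma abs_trace_eq_relative: "abs_trace x = (\<Sum>i<m. (x + x ^ q) ^ (CHAR('a) ^ i))" for x :: 'a
proof -
  have "(\<Sum>i<m + k. g i) = (\<Sum>i<m. g i) + (\<Sum>i<k. g (m + i))" for g :: "nat \<Rightarrow> 'a" and k
    by (induction k) (simp_all add: add.assoc)
  then have "abs_trace x = (\<Sum>i<m. x ^ (CHAR('a) ^ i)) + (\<Sum>i<m. x ^ (CHAR('a) ^ (m + i)))"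
    by (simp add: abs_trace_def ext_degree_eq)
  also have "\<dots> = (\<Sum>i<m. x ^ (CHAR('a) ^ i) + (x ^ q) ^ (CHAR('a) ^ i))"
    by (simp add: q_def sum.distrib power_add flip: power_mult)
  finally show ?thesis by (simp add: add_power_CHAR_power)
qed

lemma relative_trace_in_F: "x + x ^ q \<in> F"
  by (simp add: F_def power_q_add power_q_q add.commute)

text \<open>The trace polynomial of \<open>F\<close> has degree at most
  \<open>p ^ (m - 1) < q\<close>, too small to vanish on all of \<open>F\<close>.\<close>

lemma ex_subfield_trace_nonzero: "\<exists>x\<in>F. (\<Sum>i<m. x ^ (CHAR('a) ^ i)) \<noteq> 0"
proof (rule ccontr)
  assume neg: "\<not> ?thesis"
  let ?p = "CHAR('a)"
  let ?P = "\<Sum>i<m. monom (1::'a) (?p ^ i)"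
  have p: "?p > 1" using prime_gt_1_nat prime_CHAR_finite_field by blast
  have m: "m > 0" using q_ge_2 by (cases m) (auto simp: q_def)
  have "coeff ?P (?p ^ (m - 1)) = (\<Sum>i<m. if i = m - 1 then 1 else 0)"
    using p by (simp add: coeff_sum)
  also have "\<dots> = 1" using m by simp
  finally have P: "?P \<noteq> 0" by (metis coeff_0 zero_neq_one)
  have "degree ?P \<le> ?p ^ (m - 1)"
  proof (rule degree_sum_le)
    fix i assume "i \<in> {..<m}"
    then have "?p ^ i \<le> ?p ^ (m - 1)" using p by (intro power_increasing) auto
    then show "degree (monom (1::'a) (?p ^ i)) \<le> ?p ^ (m - 1)"
      using degree_monom_le order_trans by blast
  qed simp
  also have "\<dots> < q" using p m by (simp add: q_def)
  finally have deg: "degree ?P < q" .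
  have "card F \<le> card {x. poly ?P x = 0}"
  proof (rule card_mono)
    have "poly ?P x = 0" if "x \<in> F" for x
    proof -
      have "poly ?P x = (\<Sum>i<m. x ^ (?p ^ i))"
        by (simp only: poly_sum poly_monom mult_1)
      also have "\<dots> = 0" using neg that by blast
      finally show ?thesis .
    qed
    then show "F \<subseteq> {x. poly ?P x = 0}" by blast
  qed simp
  then show False using deg card_poly_roots_bound[OF P] card_F by linarith
qed

text \<open>Character orthogonality on \<open>F\<close>: the trace of \<open>y * z\<close> is the
  subfield trace of \<open>y * (z + z ^ q)\<close>, so the character is trivial exactly when the
  relative trace of \<open>z\<close> vanishes.\<close>

lemma sum_add_char_F:
  "(\<Sum>y\<in>F. add_char (y * z)) = (if z + z ^ q = 0 then of_nat q else 0)"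
proof -
  have tr: "abs_trace (y * z) = (\<Sum>i<m. (y * (z + z ^ q)) ^ (CHAR('a) ^ i))" if "y \<in> F" for y
    using that by (simp add: abs_trace_eq_relative F_def power_mult_distrib distrib_left)
  show ?thesis
  proof (cases "z + z ^ q = 0")
    case True
    have "add_char (y * z) = 1" if "y \<in> F" for y
    proof -
      have "CHAR('a) > 0" using prime_gt_0_nat prime_CHAR_finite_field by blast
      then show ?thesis using tr[OF that] True by (simp add: add_char_eq_1_iff power_0_left)
    qed
    then show ?thesis using True by (simp add: card_F)
  next
    case False
    let ?c = "z + z ^ q"
    have z: "z \<noteq> 0" using False by auto
    obtain x where x: "x \<in> F" "(\<Sum>i<m. x ^ (CHAR('a) ^ i)) \<noteq> 0"
      using ex_subfield_trace_nonzero by auto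
    have y: "x / ?c \<in> F"
      using x relative_trace_in_F[of z] by (simp add: F_def power_divide)
    have "abs_trace (x / ?c * z) \<noteq> 0"
      using tr[OF y] x False by simp
    then have ne: "add_char (x / ?c * z) \<noteq> 1"
      by (simp add: add_char_eq_1_iff)
    let ?H = "(\<lambda>y. y * z) ` F"
    have "(\<Sum>y\<in>F. add_char (y * z)) = (\<Sum>w\<in>?H. add_char w)"
      using z by (subst sum.reindex) (auto simp: inj_on_def)
    also have "\<dots> = 0"
    proof (rule sum_add_char_subgroup)
      show "x / ?c * z \<in> ?H" using y by blast
      fix v w assume "v \<in> ?H" "w \<in> ?H"
      then obtain v' w' where "v = v' * z" "w = w' * z" "v' \<in> F" "w' \<in> F" by auto
      then show "v + w \<in> ?H"
        by (intro image_eqI[of _ _ "v' + w'"]) (auto simp: F_def power_q_add distrib_right)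
    qed (rule ne)
    finally show ?thesis using False by simp
  qed
qed

subsection \<open>The Weil sum as a count of incident lines\<close>

text \<open>For \<open>u\<close> in \<open>U\<close> this is an affine line of the field seen as a
  plane over \<open>F\<close>.\<close>

definition line :: "int \<Rightarrow> 'a \<Rightarrow> 'a set" where
  "line s u = {a. u powi s + u powi (1 - s) + a + a ^ q * u = 0}"

definition count :: "int \<Rightarrow> 'a \<Rightarrow> nat" where
  "count s a = card {u \<in> U. a \<in> line s u}"

lemma powi_q_minus_1_F: "y powi (1 + s * (int q - 1)) = y" if "y \<in> F" "y \<noteq> 0"
proof -
  have "y ^ (q - 1) = 1" using that by (auto simp: F_eq)
  then have "y powi (int q - 1) = 1"
    using q_ge_2 power_int_of_nat[of y "q - 1"] by (simp add: of_nat_diff)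
  then show ?thesis
    using that by (simp add: power_int_add mult.commute[of s] power_int_mult)
qed

text \<open>With \<open>u = x ^ (q - 1)\<close>, each summand of the relative trace is
  \<open>x\<close> times a term in \<open>u\<close> and \<open>a\<close>:
  \<open>x ^ q = x u\<close>, \<open>x powi d = x u powi s\<close>, and conjugation inverts
  \<open>u powi s\<close>.\<close>

lemma relative_trace_eq_0_iff:
  assumes x: "x \<noteq> 0" and d: "d = 1 + s * (int q - 1)"
  shows "(x powi d + a * x) + (x powi d + a * x) ^ q = 0 \<longleftrightarrow> a \<in> line s (x ^ (q - 1))"
proof -
  let ?u = "x ^ (q - 1)"
  have u: "?u \<in> U" using x power_image_eq_U by auto
  have u': "?u = x powi (int q - 1)"
    using q_ge_2 power_int_of_nat[of x "q - 1"] by (simp add: of_nat_diff)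
  have xq: "x ^ q = x * ?u" using q_ge_2 by (cases q) auto
  have xd: "x powi d = x * ?u powi s"
    unfolding u' using x by (simp add: d power_int_add mult.commute[of s] power_int_mult)
  have "(?u powi s) ^ q = inverse (?u powi s)"
    using power_q_U[OF powi_in_U[OF u]] .
  also have "?u * \<dots> = ?u powi (1 - s)"
    using U_nonzero[OF u] by (simp add: power_int_diff field_simps)
  finally have us: "?u * (?u powi s) ^ q = ?u powi (1 - s)" by simp
  have "(x powi d + a * x) + (x powi d + a * x) ^ q
      = x * ?u powi s + a * x + (x * ?u * (?u powi s) ^ q + a ^ q * (x * ?u))"
    by (simp add: power_q_add xd power_mult_distrib xq)
  also have "\<dots> = x * (?u powi s + a + ?u * (?u powi s) ^ q + a ^ q * ?u)"
    by (simp add: algebra_simps)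
  also have "\<dots> = x * (?u powi s + ?u powi (1 - s) + a + a ^ q * ?u)"
    by (simp only: us ac_simps)
  finally show ?thesis using x by (simp add: line_def)
qed

lemma card_fibre_power:
  "u \<in> U \<Longrightarrow> card {x. x \<noteq> 0 \<and> x ^ (q - 1) = u} = q - 1"
  using card_fibre_mult_hom[of "UNIV - {0::'a}" "\<lambda>x. x ^ (q - 1)" u]
  by (simp add: power_mult_distrib power_image_eq_U card_kernel del: One_nat_def)

text \<open>Replacing \<open>x\<close> by \<open>y x\<close> with \<open>y\<close> in the subfield multiplies \<open>x powi d + a * x\<close> by \<open>y\<close>;
  averaging over \<open>y\<close> turns the Weil sum into a count of zeros of the relative trace.\<close>
lemma weil_sum_eq_count:
  assumes d: "d = 1 + s * (int q - 1)" "d \<noteq> 0"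
  shows "weil_sum d a = of_nat q * (of_nat (count s a) - 1)"
proof -
  let ?G = "UNIV - {0::'a}" and ?g = "\<lambda>x. x powi d + a * x"
  let ?Z = "{x \<in> ?G. ?g x + ?g x ^ q = 0}"
  have char0: "add_char (0::'a) = 1" by (rule add_char_0)
  \<comment> \<open>Since \<open>d\<close> is non-zero, \<open>0 powi d = 0\<close>, so
    \<open>x = 0\<close> contributes 1.\<close>
  have split: "weil_sum d a = 1 + (\<Sum>x\<in>?G. add_char (?g x))"
    using d by (simp add: weil_sum_def sum.remove[of UNIV "0::'a"] char0)
  have scale: "weil_sum d a - 1 = (\<Sum>x\<in>?G. add_char (y * ?g x))" if y: "y \<in> F - {0}" for y
  proof -
    have yd: "y powi d = y" using powi_q_minus_1_F y d by simp
    have "(\<Sum>x\<in>?G. add_char (?g x)) = (\<Sum>x\<in>?G. add_char (?g (y * x)))"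
      by (rule sum.reindex_bij_witness[of _ "\<lambda>x. y * x" "\<lambda>x. x / y"]) (use y in auto)
    also have "\<dots> = (\<Sum>x\<in>?G. add_char (y * ?g x))"
      by (simp add: power_int_mult_distrib yd algebra_simps)
    finally show ?thesis using split by simp
  qed
  have cF: "card (F - {0}) = q - 1"
    using card_F by (simp add: F_def card_Diff_subset)
  have "of_nat (q - 1) * (weil_sum d a - 1) = (\<Sum>y\<in>F - {0}. \<Sum>x\<in>?G. add_char (y * ?g x))"
  proof -
    have "(\<Sum>y\<in>F - {0}. \<Sum>x\<in>?G. add_char (y * ?g x)) = (\<Sum>y\<in>F - {0}. weil_sum d a - 1)"
      by (intro sum.cong refl scale[symmetric])
    then show ?thesis by (simp add: cF)
  qed
  also have "\<dots> = (\<Sum>x\<in>?G. \<Sum>y\<in>F - {0}. add_char (y * ?g x))"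
    by (rule sum.swap)
  \<comment> \<open>Orthogonality over all of \<open>F\<close>, less the contribution 1 of
    \<open>y = 0\<close>.\<close>
  also have "\<dots> = (\<Sum>x\<in>?G. (if x \<in> ?Z then of_nat q else 0) - 1)"
  proof (rule sum.cong)
    fix x assume "x \<in> ?G"
    moreover have "(\<Sum>y\<in>F - {0}. add_char (y * ?g x)) = (\<Sum>y\<in>F. add_char (y * ?g x)) - 1"
      by (subst sum_diff1) (auto simp: F_def char0)
    ultimately show "(\<Sum>y\<in>F - {0}. add_char (y * ?g x)) = (if x \<in> ?Z then of_nat q else 0) - 1"
      by (simp only: sum_add_char_F) auto
  qed simp
  also have "\<dots> = of_nat (card ?Z) * of_nat q - of_nat (card ?G)"
    by (simp add: sum_subtractf sum.If_cases Int_def)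
  \<comment> \<open>Membership in \<open>?Z\<close> depends only on \<open>x ^ (q - 1)\<close>, and
    each point of \<open>U\<close> has \<open>q - 1\<close> preimages.\<close>
  also have "card ?Z = count s a * (q - 1)"
  proof -
    let ?Y = "{x. x \<noteq> 0 \<and> a \<in> line s (x ^ (q - 1))}"
    have "?Z = ?Y"
    proof (rule Collect_cong)
      fix x show "(x \<in> ?G \<and> ?g x + ?g x ^ q = 0) = (x \<noteq> 0 \<and> a \<in> line s (x ^ (q - 1)))"
        using relative_trace_eq_0_iff[OF _ d(1), of x a] by blast
    qed
    then have "card ?Z = card ?Y" by (rule arg_cong)
    also have "\<dots> = card ((\<lambda>x. x ^ (q - 1)) ` ?Y) * (q - 1)"
    proof (rule card_eq_card_image_times_fibre)
      fix u assume u: "u \<in> (\<lambda>x. x ^ (q - 1)) ` ?Y"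
      then have "a \<in> line s u" by blast
      then have "{x \<in> ?Y. x ^ (q - 1) = u} = {x. x \<noteq> 0 \<and> x ^ (q - 1) = u}"
        by auto
      moreover have "u \<in> U" using u power_image_eq_U by blast
      ultimately show "card {x \<in> ?Y. x ^ (q - 1) = u} = q - 1"
        by (simp only: card_fibre_power)
    qed simp
    also have "(\<lambda>x. x ^ (q - 1)) ` ?Y = {u \<in> U. a \<in> line s u}"
      unfolding power_image_eq_U[symmetric] by blast
    finally show ?thesis by (simp add: count_def)
  qed
  also have "card ?G = (q - 1) * (q + 1)" using card_nonzero by (simp only: mult.commute)
  finally have eq: "of_nat (q - 1) * (weil_sum d a - 1)
      = of_nat (q - 1) * (of_nat q * of_nat (count s a) - of_nat (q + 1))"
    by (simp only: of_nat_mult right_diff_distrib ac_simps)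
  have ne: "of_nat (q - 1) \<noteq> (0::complex)"
    using q_ge_2 by (subst of_nat_eq_0_iff) simp
  have "weil_sum d a - 1 = of_nat q * of_nat (count s a) - of_nat (q + 1)"
    by (rule mult_left_cancel[THEN iffD1, OF ne eq])
  then show ?thesis by (simp add: algebra_simps)
qed

subsection \<open>The configuration of lines\<close>

lemma power_q_powi_U: "(u powi k) ^ q = u powi (- k)" if "u \<in> U"
  using power_q_U[OF powi_in_U[OF that]] by (simp add: power_int_minus)

text \<open>Conjugation followed by multiplication by \<open>u\<close> swaps the two summands. The
  equation of a line is thus self-conjugate.\<close>

lemma line_constant_conj:
  "u * (u powi s + u powi (1 - s)) ^ q = u powi s + u powi (1 - s)" if "u \<in> U"
proof -
  have "u * u powi k = u powi (k + 1)" for k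
    using U_nonzero[OF that] by (simp add: power_int_add_1')
  then show ?thesis
    by (simp add: power_q_add power_q_powi_U[OF that] distrib_left add.commute)
qed

text \<open>The additive map \<open>a + a ^ q * u\<close> has kernel of order at most
  \<open>q\<close> and image inside \<open>?I\<close>, also of order at most \<open>q\<close>. As
  the orders multiply to \<open>q ^ 2\<close>, the image is all of \<open>?I\<close>, which contains
  the negated constant term.\<close>

lemma card_line: "card (line s u) = q" if u: "u \<in> U"
proof -
  let ?f = "\<lambda>a::'a. a + a ^ q * u"
  let ?k = "card {a. ?f a = 0}" and ?I = "{z. z ^ q * u = z}"
  have u0: "u \<noteq> 0" using U_nonzero[OF u] .
  have add: "?f (a + b) = ?f a + ?f b" for a b
    by (simp add: power_q_add distrib_right)
  have fib: "card {a. ?f a = b} = ?k" if "b \<in> range ?f" for b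
    using card_fibre_add_hom[of ?f b, OF add that] .
  have "q ^ 2 = card (range ?f) * ?k"
    using card_eq_card_image_times_fibre[of UNIV ?f ?k] fib card_K by simp
  moreover have k: "?k \<le> q"
  proof -
    have "card {a::'a. u * a ^ q + 1 * a + 0 = 0} \<le> q"
      by (rule card_roots_trinomial_le) (use u0 q_ge_2 in auto)
    then show ?thesis by (simp add: algebra_simps)
  qed
  moreover have sub: "range ?f \<subseteq> ?I"
    using u0 by (auto simp: power_q_add power_mult_distrib power_q_q power_q_U[OF u] distrib_right)
  have I: "card ?I \<le> q"
  proof -
    have "card {a::'a. u * a ^ q + (-1) * a + 0 = 0} \<le> q"
      by (rule card_roots_trinomial_le) (use u0 q_ge_2 in auto)
    then show ?thesis by (simp add: algebra_simps)
  qed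
  have im: "card (range ?f) \<le> card ?I" using sub by (intro card_mono) auto
  ultimately have kq: "?k = q" and "card ?I \<le> card (range ?f)"
  proof -
    assume e: "q ^ 2 = card (range ?f) * ?k"
    have r: "card (range ?f) \<le> q" using im I by simp
    have q0: "q > 0" using q_ge_2 by simp
    have "q * q \<le> q * ?k"
      using mult_le_mono1[OF r, of ?k] e by (simp add: power2_eq_square)
    then show "?k = q" using k q0 by simp
    then have "q * q = card (range ?f) * q" using e by (simp add: power2_eq_square)
    then show "card ?I \<le> card (range ?f)" using q0 I by simp
  qed
  then have "range ?f = ?I" using sub by (intro card_seteq) auto
  moreover have "- (u powi s + u powi (1 - s)) \<in> ?I"
    unfolding mem_Collect_eq power_q_minus mult_minus_left
    by (subst mult.commute) (simp only: line_constant_conj[OF u])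
  ultimately have "- (u powi s + u powi (1 - s)) \<in> range ?f" by simp
  from fib[OF this] have "card {a. ?f a = - (u powi s + u powi (1 - s))} = q"
    by (simp only: kq)
  moreover have "{a. ?f a = - (u powi s + u powi (1 - s))} = line s u"
    unfolding line_def by (rule Collect_cong) (simp only: eq_neg_iff_add_eq_0 add_ac)
  ultimately show ?thesis by simp
qed

lemma ex1_line_inter:
  assumes u: "u \<in> U" and v: "v \<in> U" and uv: "u \<noteq> v"
  shows "\<exists>!a. a \<in> line s u \<and> a \<in> line s v"
proof -
  define c d where "c = u powi s + u powi (1 - s)" and "d = v powi s + v powi (1 - s)"
  \<comment> \<open>Subtracting the two equations forces \<open>a ^ q = b\<close>, so
    \<open>b ^ q\<close> is the only candidate; \<open>c ^ q = c / u\<close> and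
    \<open>d ^ q = d / v\<close> show that it works.\<close>
  define b where "b = (d - c) / (u - v)"
  have nz: "u \<noteq> 0" "v \<noteq> 0" "u - v \<noteq> 0" "v - u \<noteq> 0" using u v uv U_nonzero by auto
  have cd: "c ^ q = c / u" "d ^ q = d / v"
    using line_constant_conj[OF u, of s] line_constant_conj[OF v, of s] nz
    by (simp_all add: c_def d_def field_simps)
  have bq: "b ^ q = (d * u - c * v) / (v - u)"
  proof -
    have "b ^ q = (d / v - c / u) / (inverse u - inverse v)"
      by (simp add: b_def power_divide power_q_diff cd power_q_U u v)
    also have "\<dots> = (d * u - c * v) / (v - u)"
      using nz by (simp add: field_simps)
    finally show ?thesis .
  qed
  show ?thesis
  proof (rule ex1I[of _ "b ^ q"])
    have "c + b ^ q + b * u = 0" "d + b ^ q + b * v = 0"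
      unfolding bq unfolding b_def using nz by (simp_all add: divide_simps) (simp_all add: algebra_simps)
    then show "b ^ q \<in> line s u \<and> b ^ q \<in> line s v"
      by (simp add: line_def c_def d_def power_q_q)
    fix a assume "a \<in> line s u \<and> a \<in> line s v"
    then have "c + a + a ^ q * u = 0" "d + a + a ^ q * v = 0"
      by (auto simp: line_def c_def d_def)
    moreover have "a ^ q * (u - v) = ((c + a + a ^ q * u) - (d + a + a ^ q * v)) + (d - c)"
      by (simp add: algebra_simps)
    ultimately have "a ^ q * (u - v) = d - c" by simp
    then have "a ^ q = b" using nz by (simp add: b_def field_simps)
    then show "a = b ^ q" using power_q_q[of a] by simp
  qed
qed

text \<open>Double counting: the line itself contributes \<open>q\<close> incidences, each of the
  \<open>q\<close> other lines exactly one.\<close>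

lemma sum_count_line:
  assumes u: "u \<in> U"
  shows "(\<Sum>a\<in>line s u. count s a) = q + q"
proof -
  have "(\<Sum>a\<in>line s u. count s a) = (\<Sum>a\<in>line s u. \<Sum>v\<in>U. if a \<in> line s v then 1 else 0)"
    by (simp add: count_def sum.If_cases Int_def)
  also have "\<dots> = (\<Sum>v\<in>U. \<Sum>a\<in>line s u. if a \<in> line s v then 1 else 0)"
    by (rule sum.swap)
  also have "\<dots> = (\<Sum>v\<in>U. card (line s u \<inter> line s v))"
    by (simp add: sum.If_cases)
  also have "\<dots> = card (line s u) + (\<Sum>v\<in>U - {u}. card (line s u \<inter> line s v))"
    using u by (subst sum.remove[of U u]) auto
  also have "(\<Sum>v\<in>U - {u}. card (line s u \<inter> line s v)) = (\<Sum>v\<in>U - {u}. 1)"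
  proof (rule sum.cong)
    fix v assume "v \<in> U - {u}"
    then have "\<exists>!a. a \<in> line s u \<and> a \<in> line s v"
      using ex1_line_inter[OF u, of v s] by blast
    then obtain a where "a \<in> line s u \<inter> line s v" "\<And>b. b \<in> line s u \<inter> line s v \<Longrightarrow> b = a"
      by blast
    then have "line s u \<inter> line s v = {a}" by blast
    then show "card (line s u \<inter> line s v) = 1" by simp
  qed simp
  also have "\<dots> = q" using u by (simp add: card_U)
  finally show ?thesis by (simp add: card_line[OF u])
qed

lemma sum_count: "(\<Sum>a\<in>UNIV. count s a) = (q + 1) * q"
proof -
  have "(\<Sum>a\<in>UNIV. count s a) = (\<Sum>a\<in>UNIV. \<Sum>v\<in>U. if a \<in> line s v then 1 else 0)"
    by (simp add: count_def sum.If_cases Int_def)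
  also have "\<dots> = (\<Sum>v\<in>U. \<Sum>a\<in>UNIV. if a \<in> line s v then 1 else 0)"
    by (rule sum.swap)
  also have "\<dots> = (\<Sum>v\<in>U. q)"
    by (intro sum.cong refl) (simp add: sum.If_cases card_line)
  finally show ?thesis by (simp add: card_U)
qed

text \<open>If the lines cover the plane, the total excess \<open>count - 1\<close> over the plane equals that
  over any single line, so points of multiplicity at least two lie on every line.\<close>
lemma count_eq_if_covering:
  assumes cover: "\<And>a. count s a \<ge> 1" and a: "count s a \<ge> 2"
  shows "count s a = q + 1"
proof -
  have "a \<in> line s u" if u: "u \<in> U" for u
  proof (rule ccontr)
    assume na: "a \<notin> line s u"
    \<comment> \<open>Off the line there are \<open>q ^ 2 - q\<close> points and
      \<open>(q + 1) q - 2 q\<close> incidences, which is the same number; the excess at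
      \<open>a\<close> is a contradiction.\<close>
    have "(\<Sum>b\<in>- line s u. 1) < (\<Sum>b\<in>- line s u. count s b)"
    proof (rule sum_strict_mono_ex1)
      show "\<exists>b\<in>- line s u. 1 < count s b" using na a by (intro bexI[of _ a]) auto
    qed (use cover in auto)
    then have "card (- line s u) < (\<Sum>b\<in>- line s u. count s b)" by simp
    moreover have "(\<Sum>b\<in>UNIV. count s b) = (\<Sum>b\<in>line s u. count s b) + (\<Sum>b\<in>- line s u. count s b)"
      by (subst sum.union_disjoint[symmetric]) auto
    moreover have "card (- line s u) = q ^ 2 - q"
      by (simp only: Compl_eq_Diff_UNIV card_Diff_subset finite subset_UNIV card_K card_line[OF u])
    moreover have "q \<le> q * q" by simp
    ultimately show False
      by (simp add: sum_count sum_count_line[OF u] power2_eq_square)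
  qed
  then have "{u \<in> U. a \<in> line s u} = U" by auto
  then show ?thesis by (simp add: count_def card_U)
qed

text \<open>On the line through 0 the counts add up to \<open>2 q\<close>; if all others were at
  most 2, the sum would be at most \<open>1 + 2 (q - 1)\<close>.\<close>

lemma ex_count_ge_3:
  assumes "count s 0 = 1"
  shows "\<exists>a. a \<noteq> 0 \<and> count s a \<ge> 3"
proof (rule ccontr)
  assume neg: "\<not> ?thesis"
  obtain u where u: "u \<in> U" "0 \<in> line s u"
    using assms by (metis (mono_tags, lifting) card_1_singletonE count_def insertI1 mem_Collect_eq)
  have "q + q = count s 0 + (\<Sum>a\<in>line s u - {0}. count s a)"
    using sum_count_line[OF u(1), of s] u by (subst (asm) sum.remove[of _ 0]) auto
  also have "(\<Sum>a\<in>line s u - {0}. count s a) \<le> (\<Sum>a\<in>line s u - {0}. 2)"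
    using neg by (intro sum_mono) (auto simp: not_le)
  also have "\<dots> = 2 * (q - 1)" using u by (simp add: card_line)
  finally show False using assms q_ge_2 by simp
qed

subsection \<open>Values of the count at the points of the unit circle\<close>

definition ker :: "int \<Rightarrow> 'a set" where "ker k = {u \<in> U. u powi k = 1}"

definition img :: "int \<Rightarrow> 'a set" where "img k = (\<lambda>u. u powi k) ` U"

lemma minus_one_in_U: "- 1 \<in> U"
  using power_q_minus[of 1] by (simp add: U_def)

lemma img_subset: "img k \<subseteq> U"
  using powi_in_U by (auto simp: img_def)

lemma one_in_img: "1 \<in> img k"
  using one_in_U by (auto simp: img_def intro!: image_eqI[of _ _ 1])

lemma one_in_ker: "1 \<in> ker k"
  using one_in_U by (simp add: ker_def)

lemma mult_in_img: "a \<in> img k \<Longrightarrow> b \<in> img k \<Longrightarrow> a * b \<in> img k"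
  using mult_in_U by (auto simp: img_def simp flip: power_int_mult_distrib)

lemma mult_in_ker: "a \<in> ker k \<Longrightarrow> b \<in> ker k \<Longrightarrow> a * b \<in> ker k"
  using mult_in_U by (auto simp: ker_def power_int_mult_distrib)

lemma card_ker_pos: "card (ker k) > 0"
  using one_in_ker by (auto simp: card_gt_0_iff)

lemma card_fibre_powi: "card {u \<in> U. u powi k = a} = (if a \<in> img k then card (ker k) else 0)"
proof (cases "a \<in> img k")
  case True
  have "card {u \<in> U. u powi k = a} = card {u \<in> U. u powi k = 1}"
    by (rule card_fibre_mult_hom)
      (use True U_nonzero mult_in_U inverse_in_U in \<open>auto simp: img_def power_int_mult_distrib\<close>)
  then show ?thesis using True by (simp add: ker_def)
next
  case False
  then have "{u \<in> U. u powi k = a} = {}" by (auto simp: img_def)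
  then show ?thesis using False by simp
qed

lemma card_img_times_card_ker: "card (img k) * card (ker k) = q + 1"
  using card_eq_card_image_times_fibre[of U "\<lambda>u. u powi k" "card (ker k)"]
  by (simp add: card_fibre_powi img_def card_U)

lemma img_eq_U_iff: "img k = U \<longleftrightarrow> card (ker k) = 1"
proof
  assume "img k = U"
  then have "(q + 1) * card (ker k) = (q + 1) * 1"
    using card_img_times_card_ker[of k] by (simp add: card_U)
  then show "card (ker k) = 1" by (simp only: mult_cancel1) simp
next
  assume "card (ker k) = 1"
  then have "card U \<le> card (img k)"
    using card_img_times_card_ker[of k] by (simp add: card_U)
  then show "img k = U"
    using img_subset by (intro card_seteq) auto
qed

lemma powi_eq_mult: "u powi s = u powi (1 - s) * u powi (2 * s - 1)" if "u \<in> U"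
  using U_nonzero[OF that] by (simp flip: power_int_add)

lemma powi_mult_powi_diff: "u powi s * u powi (1 - s) = u" if "u \<in> U"
  using U_nonzero[OF that] by (simp flip: power_int_add)

text \<open>On the unit circle the equation of a line factors:
  \<open>X + Y - a - X Y / a = (X - a) (1 - Y / a)\<close> with \<open>X = u powi s\<close>, \<open>Y = u powi (1 - s)\<close>.\<close>
lemma uminus_in_line_iff:
  assumes a: "a \<in> U" and u: "u \<in> U"
  shows "- a \<in> line s u \<longleftrightarrow> u powi s = a \<or> u powi (1 - s) = a"
proof -
  define X Y where "X = u powi s" and "Y = u powi (1 - s)"
  have a0: "a \<noteq> 0" using U_nonzero[OF a] .
  have XY: "u = X * Y" using powi_mult_powi_diff[OF u] by (simp add: X_def Y_def)
  have "X + Y + - a + (- a) ^ q * u = (X - a) * (1 - Y / a)"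
    using a0 by (simp add: power_q_minus power_q_U[OF a] XY field_simps)
  then have "- a \<in> line s u \<longleftrightarrow> (X - a) * (1 - Y / a) = 0"
    by (simp only: line_def X_def Y_def mem_Collect_eq)
  also have "\<dots> \<longleftrightarrow> X = a \<or> Y = a"
    using a0 by auto
  finally show ?thesis by (simp add: X_def Y_def)
qed

lemma count_reflect: "count (1 - s) a = count s a"
  by (simp add: count_def line_def add.commute)

lemma ker_inter: "ker s \<inter> ker (1 - s) = {1}"
proof -
  have "u = 1" if "u \<in> ker s" "u \<in> ker (1 - s)" for u
    using that powi_mult_powi_diff[of u s] by (simp add: ker_def)
  then show ?thesis using one_in_ker by blast
qed

text \<open>The case \<open>a = 1\<close> of the factorisation; the two kernels share only
  1.\<close>

lemma count_minus_one: "count s (- 1) = card (ker s) + card (ker (1 - s)) - 1"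
proof -
  have "{u \<in> U. - 1 \<in> line s u} = ker s \<union> ker (1 - s)"
    using uminus_in_line_iff[OF one_in_U] by (auto simp: ker_def)
  then have "count s (- 1) = card (ker s \<union> ker (1 - s))" by (simp add: count_def)
  then show ?thesis
    using card_Un_Int[of "ker s" "ker (1 - s)"] by (simp add: ker_inter)
qed

text \<open>A field has at most \<open>k\<close> roots of \<open>x ^ k = 1\<close>, so kernels of
  equal order coincide, although they meet only in 1.\<close>

lemma card_ker_neq:
  assumes "card (ker s) > 1"
  shows "card (ker s) \<noteq> card (ker (1 - s))"
proof
  assume eq: "card (ker s) = card (ker (1 - s))"
  let ?R = "{x::'a. x ^ card (ker s) = 1}"
  have "x ^ card (ker k) = 1" if "x \<in> ker k" for k x
    by (rule power_card_mult_closed[OF _ _ mult_in_ker that]) (use U_nonzero in \<open>auto simp: ker_def\<close>)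
  then have roots: "ker k \<subseteq> {x. x ^ card (ker k) = 1}" for k by blast
  then have sub: "ker s \<subseteq> ?R" "ker (1 - s) \<subseteq> ?R"
    using roots[of "1 - s", folded eq] by auto
  have "card ?R \<le> card (ker s)" using assms by (intro card_roots_of_unity_le) simp
  then have "ker s = ?R" "ker (1 - s) = ?R"
    using sub eq card_seteq[OF finite sub(1)] card_seteq[OF finite sub(2)] by simp_all
  then have "ker s = {1}" using ker_inter[of s] by simp
  then show False using assms by simp
qed

text \<open>Otherwise \<open>img (1 - s)\<close> contains \<open>u powi s\<close> and
  \<open>u powi (1 - s)\<close>, hence their product \<open>u\<close>, for all \<open>u\<close> in
  \<open>U\<close>; then the kernel would be trivial.\<close>

lemma ex_img_diff:
  assumes "card (ker (1 - s)) > 1"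
  shows "\<exists>a. a \<in> img s \<and> a \<notin> img (1 - s)"
proof (rule ccontr)
  assume "\<not> ?thesis"
  then have sub: "img s \<subseteq> img (1 - s)" by blast
  have "u \<in> img (1 - s)" if "u \<in> U" for u
  proof -
    have "u powi s \<in> img (1 - s)" using sub that by (auto simp: img_def)
    moreover have "u powi (1 - s) \<in> img (1 - s)" using that by (simp add: img_def)
    ultimately show ?thesis using mult_in_img powi_mult_powi_diff[OF that] by metis
  qed
  then have "img (1 - s) = U" using img_subset by blast
  then show False using assms img_eq_U_iff by simp
qed

text \<open>Now \<open>u powi s = u\<close>, and the line equation becomes
  \<open>(1 + a) + (1 + a) ^ q * u = 0\<close>: all lines pass through \<open>-1\<close>, and any
  other point determines \<open>u\<close>.\<close>

lemma count_degenerate: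
  assumes triv: "\<And>u. u \<in> U \<Longrightarrow> u powi (1 - s) = 1"
  shows "count s a \<in> {1, q + 1}"
proof -
  define b where "b = 1 + a"
  have us: "u powi s = u" if "u \<in> U" for u
    using powi_mult_powi_diff[OF that, of s] triv[OF that] by simp
  have bq: "b ^ q = 1 + a ^ q" by (simp add: b_def power_q_add)
  have line: "a \<in> line s u \<longleftrightarrow> b ^ q * u + b = 0" if "u \<in> U" for u
    using us[OF that] triv[OF that] unfolding bq
    by (simp add: line_def b_def algebra_simps)
  show ?thesis
  proof (cases "b = 0")
    case True
    then have "{u \<in> U. a \<in> line s u} = U" using line by auto
    then show ?thesis by (simp add: count_def card_U)
  next
    case False
    have "(- b / b ^ q) ^ (q + 1) = 1"
      using False by (simp add: power_divide power_q_minus power_q_q)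
    then have "- b / b ^ q \<in> U" by (simp add: U_def)
    moreover have "b ^ q * u + b = 0 \<longleftrightarrow> u = - b / b ^ q" for u
      using False by (simp add: field_simps eq_neg_iff_add_eq_0)
    ultimately have "{u \<in> U. a \<in> line s u} = {- b / b ^ q}" using line by auto
    then show ?thesis by (simp add: count_def)
  qed
qed

section \<open>Values of the count at non-zero points\<close>

definition spectrum :: "int \<Rightarrow> nat set" where
  "spectrum s = count s ` (UNIV - {0})"

lemma spectrumI: "a \<noteq> 0 \<Longrightarrow> count s a = k \<Longrightarrow> k \<in> spectrum s"
  by (auto simp: spectrum_def)

lemma spectrum_reflect: "spectrum (1 - s) = spectrum s"
  by (simp add: spectrum_def count_reflect[abs_def])

lemma card_spectrum_neq_3I:
  assumes "{a, b, c, d} \<subseteq> spectrum s" "distinct [a, b, c, d]"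
  shows "card (spectrum s) \<noteq> 3"
proof -
  have "card {a, b, c, d} \<le> card (spectrum s)"
    using assms by (intro card_mono) (auto simp: spectrum_def)
  then show ?thesis using assms(2) by simp
qed

lemma spectrum_degenerate:
  assumes "\<And>u. u \<in> U \<Longrightarrow> u powi (1 - s) = 1"
  shows "card (spectrum s) \<noteq> 3"
proof -
  have "card (spectrum s) \<le> card {1, q + 1}"
    using count_degenerate[OF assms] by (intro card_mono) (auto simp: spectrum_def)
  also have "\<dots> \<le> 2" by (simp add: card_insert_if)
  finally show ?thesis by simp
qed

text \<open>This assumption is what coprimality of \<open>d\<close> to the group order yields, since
  \<open>d\<close> is \<open>1 - 2 s\<close> modulo \<open>q + 1\<close>.\<close>

context
  fixes s :: int
  assumes ker_trivial: "ker (2 * s - 1) = {1}"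
begin

text \<open>A common point of the two fibres satisfies \<open>u powi (2 * s - 1) = 1\<close>, hence
  \<open>u = 1\<close> and \<open>a = 1\<close>.\<close>

lemma count_minus:
  assumes a: "a \<in> U" "a \<noteq> 1"
  shows "count s (- a) = (if a \<in> img s then card (ker s) else 0)
    + (if a \<in> img (1 - s) then card (ker (1 - s)) else 0)"
proof -
  have disj: "{u \<in> U. u powi s = a} \<inter> {u \<in> U. u powi (1 - s) = a} = {}"
  proof -
    have False if "u \<in> U" "u powi s = a" "u powi (1 - s) = a" for u
    proof -
      have "u \<in> ker (2 * s - 1)"
        using that powi_eq_mult[of u s] U_nonzero[OF a(1)] by (simp add: ker_def)
      then have "u = 1" using ker_trivial by simp
      then show False using that a by simp
    qed
    then show ?thesis by blast
  qed
  have "{u \<in> U. - a \<in> line s u} = {u \<in> U. u powi s = a} \<union> {u \<in> U. u powi (1 - s) = a}"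
    using uminus_in_line_iff[OF a(1)] by blast
  then show ?thesis
    by (simp only: count_def card_Un_disjoint[OF _ _ disj] finite card_fibre_powi)
qed

text \<open>Lines through 0 are given by \<open>u powi (2 * s - 1) = - 1\<close>, and this power map
  is bijective on \<open>U\<close>.\<close>

lemma count_0: "count s 0 = 1"
proof -
  have img: "img (2 * s - 1) = U" using img_eq_U_iff ker_trivial by simp
  have "0 \<in> line s u \<longleftrightarrow> u powi (2 * s - 1) = - 1" if u: "u \<in> U" for u
  proof -
    have "u powi s + u powi (1 - s) = u powi (1 - s) * (u powi (2 * s - 1) + 1)"
      by (simp only: powi_eq_mult[OF u, of s] distrib_left mult_1_right)
    then show ?thesis
      using U_nonzero[OF u] by (simp add: line_def eq_neg_iff_add_eq_0)
  qed
  then have "{u \<in> U. 0 \<in> line s u} = {u \<in> U. u powi (2 * s - 1) = - 1}" by blast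
  then have "count s 0 = card {u \<in> U. u powi (2 * s - 1) = - 1}" by (simp add: count_def)
  then show ?thesis
    by (simp add: card_fibre_powi img minus_one_in_U ker_trivial)
qed

text \<open>By the covering lemma some point is missed by all lines, and it is not 0 because
  \<open>count s 0 = 1\<close>.\<close>

lemma zero_in_spectrum:
  assumes "count s a \<ge> 2" "count s a \<noteq> q + 1"
  shows "0 \<in> spectrum s"
proof -
  obtain b where "\<not> count s b \<ge> 1" using assms count_eq_if_covering by blast
  then have "count s b = 0" by simp
  moreover from this have "b \<noteq> 0" using count_0 by auto
  ultimately show ?thesis by (intro spectrumI)
qed

lemma card_spectrum_both_trivial:
  assumes e: "card (ker s) = 1" and f: "card (ker (1 - s)) = 1"
  shows "card (spectrum s) \<noteq> 3"
proof -
  have img: "img s = U" "img (1 - s) = U" using e f img_eq_U_iff by auto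
  have "\<not> U \<subseteq> {1}"
    using card_mono[of "{1::'a}" U] q_ge_2 by (auto simp: card_U)
  then obtain a where a: "a \<in> U" "a \<noteq> 1" by blast
  have 2: "count s (- a) = 2" using count_minus[OF a] a img e f by simp
  obtain c where c: "c \<noteq> 0" "count s c \<ge> 3" using ex_count_ge_3[OF count_0] by blast
  show ?thesis
  proof (rule card_spectrum_neq_3I)
    have "0 \<in> spectrum s" using 2 q_ge_2 by (intro zero_in_spectrum[of "- a"]) auto
    moreover have "1 \<in> spectrum s" using count_minus_one[of s] e f by (intro spectrumI[of "- 1"]) auto
    moreover have "2 \<in> spectrum s" using 2 a U_nonzero by (intro spectrumI[of "- a"]) auto
    moreover have "count s c \<in> spectrum s" using c by (intro spectrumI) auto
    ultimately show "{0, 1, 2, count s c} \<subseteq> spectrum s" by simp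
  qed (use c in auto)
qed

lemma card_spectrum_one_trivial:
  assumes e: "card (ker s) = 1" and f: "card (ker (1 - s)) > 1"
  shows "card (spectrum s) \<noteq> 3"
proof (cases "\<forall>u\<in>U. u powi (1 - s) = 1")
  case True
  then show ?thesis by (intro spectrum_degenerate) auto
next
  case False
  let ?f = "card (ker (1 - s))"
  obtain b where b: "b \<in> img (1 - s)" "b \<noteq> 1" using False by (auto simp: img_def)
  have bU: "b \<in> U" using b img_subset by blast
  obtain a where a: "a \<in> img s" "a \<notin> img (1 - s)" using ex_img_diff[OF f] by blast
  have aU: "a \<in> U" "a \<noteq> 1" using a img_subset one_in_img by blast+
  have img: "img s = U" using e img_eq_U_iff by auto
  have A: "count s (- a) = 1" using count_minus[OF aU] a e by simp
  have B: "count s (- b) = ?f + 1" using count_minus[OF bU b(2)] b bU img e by simp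
  have C: "count s (- 1) = ?f" using count_minus_one[of s] e by simp
  show ?thesis
  proof (rule card_spectrum_neq_3I)
    \<comment> \<open>At most one of \<open>?f\<close> and \<open>?f + 1\<close> equals
      \<open>q + 1\<close>; the other witnesses that the lines do not cover the plane.\<close>
    have "0 \<in> spectrum s"
      using B C f zero_in_spectrum[of "- 1"] zero_in_spectrum[of "- b"] by (cases "?f = q + 1") auto
    moreover have "1 \<in> spectrum s" using A aU U_nonzero by (intro spectrumI[of "- a"]) auto
    moreover have "?f + 1 \<in> spectrum s" using B bU U_nonzero by (intro spectrumI[of "- b"]) auto
    moreover have "?f \<in> spectrum s" using C by (intro spectrumI[of "- 1"]) auto
    ultimately show "{0, 1, ?f, ?f + 1} \<subseteq> spectrum s" by simp
  qed (use f in auto)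
qed

lemma card_spectrum_nontrivial:
  assumes e: "card (ker s) > 1" and f: "card (ker (1 - s)) > 1"
  shows "card (spectrum s) \<noteq> 3"
proof -
  let ?e = "card (ker s)" and ?f = "card (ker (1 - s))"
  obtain a where a: "a \<in> img s" "a \<notin> img (1 - s)" using ex_img_diff[OF f] by blast
  obtain b where b: "b \<in> img (1 - s)" "b \<notin> img s" using ex_img_diff[of "1 - s"] e by auto
  have aU: "a \<in> U" "a \<noteq> 1" and bU: "b \<in> U" "b \<noteq> 1"
    using a b img_subset one_in_img by blast+
  have A: "count s (- a) = ?e" using count_minus[OF aU] a by simp
  have B: "count s (- b) = ?f" using count_minus[OF bU] b by simp
  have C: "count s (- 1) = ?e + ?f - 1" by (rule count_minus_one)
  \<comment> \<open>So one of the two differs from \<open>q + 1\<close>, as needed for the value 0;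
    and \<open>?e + ?f - 1\<close> exceeds both.\<close>
  have ef: "?e \<noteq> ?f" by (rule card_ker_neq[OF e])
  show ?thesis
  proof (rule card_spectrum_neq_3I)
    have "0 \<in> spectrum s"
      using A B e f ef zero_in_spectrum[of "- a"] zero_in_spectrum[of "- b"] by (cases "?f = q + 1") auto
    moreover have "?e \<in> spectrum s" using A aU U_nonzero by (intro spectrumI[of "- a"]) auto
    moreover have "?f \<in> spectrum s" using B bU U_nonzero by (intro spectrumI[of "- b"]) auto
    moreover have "?e + ?f - 1 \<in> spectrum s" using C by (intro spectrumI[of "- 1"]) auto
    ultimately show "{0, ?e, ?f, ?e + ?f - 1} \<subseteq> spectrum s" by simp
  qed (use e f ef in auto)
qed

end

lemma powi_minus_one_iff:
  "u powi (- k) = 1 \<longleftrightarrow> u powi k = 1" for u :: 'a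
  by (simp add: power_int_minus)

lemma card_spectrum_neq_3:
  assumes ker: "ker (2 * s - 1) = {1}"
  shows "card (spectrum s) \<noteq> 3"
proof -
  have "2 * (1 - s) - 1 = - (2 * s - 1)" by simp
  then have ker': "ker (2 * (1 - s) - 1) = {1}"
    using ker by (simp only: ker_def powi_minus_one_iff)
  consider "card (ker s) = 1" "card (ker (1 - s)) = 1" | "card (ker s) = 1" "card (ker (1 - s)) > 1"
    | "card (ker s) > 1" "card (ker (1 - s)) = 1" | "card (ker s) > 1" "card (ker (1 - s)) > 1"
    using card_ker_pos[of s] card_ker_pos[of "1 - s"] by linarith
  then show ?thesis
  proof cases
    case 3
    then have "card (spectrum (1 - s)) \<noteq> 3"
      by (intro card_spectrum_one_trivial[OF ker']) auto
    then show ?thesis by (simp add: spectrum_reflect)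
  qed (use card_spectrum_both_trivial[OF ker] card_spectrum_one_trivial[OF ker]
      card_spectrum_nontrivial[OF ker] in blast)+
qed

section \<open>Return to Weil sums and Frobenius reduction of the exponent\<close>

lemma card_weil_sum_image:
  assumes d: "d \<noteq> 0" "[d = 1] (mod (int q - 1))" and cop: "coprime d (int CARD('a) - 1)"
  shows "card ((weil_sum d :: 'a \<Rightarrow> complex) ` (UNIV - {0})) \<noteq> 3"
proof -
  obtain s where "d - 1 = (int q - 1) * s"
    using d(2) unfolding cong_iff_dvd_diff by (rule dvdE)
  then have s: "d = 1 + s * (int q - 1)" by (simp add: mult.commute)
  have "u = 1" if u: "u \<in> U" "u powi (2 * s - 1) = 1" for u
  proof -
    have u0: "u \<noteq> 0" using U_nonzero[OF u(1)] .
    have q1: "u powi (int q + 1) = 1"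
      using u(1) power_int_of_nat[of u "q + 1"] by (simp add: U_def add.commute)
    \<comment> \<open>Hence \<open>u powi d = 1\<close>; as \<open>u\<close> is also killed by
      \<open>|K| - 1\<close>, which is coprime to \<open>d\<close>, Bezout gives
      \<open>u = 1\<close>.\<close>
    have dd: "d = (1 - 2 * s) + (int q + 1) * s" by (simp add: s algebra_simps)
    have "u powi d = u powi (1 - 2 * s)"
      unfolding dd by (subst power_int_add) (use u0 in \<open>simp_all only: power_int_mult q1
          power_int_1_left mult_1_right not_False_eq_True simp_thms\<close>)
    then have "u powi d = 1"
      using u(2) powi_minus_one_iff[of u "2 * s - 1"] by simp
    moreover have "u powi (int CARD('a) - 1) = 1"
    proof -
      have "int CARD('a) - 1 = (int q + 1) * (int q - 1)"
        by (simp add: card_K power2_eq_square algebra_simps)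
      then show ?thesis by (simp only: power_int_mult q1 power_int_1_left)
    qed
    moreover obtain x y where "x * d + y * (int CARD('a) - 1) = 1"
      using bezout_int[of d "int CARD('a) - 1"] cop by auto
    then have "u powi (d * x + (int CARD('a) - 1) * y) = u"
      by (simp add: mult.commute)
    ultimately show "u = 1"
      using u0 by (simp add: power_int_add power_int_mult)
  qed
  then have "ker (2 * s - 1) = {1}"
    using one_in_U by (auto simp: ker_def)
  from card_spectrum_neq_3[OF this] have "card (spectrum s) \<noteq> 3" .
  moreover have "(weil_sum d :: 'a \<Rightarrow> complex) ` (UNIV - {0})
      = (\<lambda>k. of_nat q * (of_nat k - 1)) ` spectrum s"
    by (simp add: spectrum_def image_image weil_sum_eq_count[OF s d(1)])
  moreover have "inj (\<lambda>k. of_nat q * (of_nat k - 1) :: complex)"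
    using q_ge_2 by (auto simp: inj_def)
  ultimately show ?thesis
    by (simp add: card_image inj_on_subset[of _ UNIV])
qed

end

text \<open>The additive character splits off \<open>a * x\<close> and absorbs the Frobenius power
  of \<open>x powi d\<close>.\<close>

lemma weil_sum_mult_CHAR_power:
  "weil_sum (d * int (CHAR('a) ^ k)) a = weil_sum d (a::'a::{finite,field})"
  unfolding weil_sum_def
proof (rule sum.cong)
  fix x :: 'a
  have "x powi (d * int (CHAR('a) ^ k)) = (x powi d) ^ (CHAR('a) ^ k)"
    by (simp only: power_int_mult power_int_of_nat)
  then show "add_char (x powi (d * int (CHAR('a) ^ k)) + a * x) = add_char (x powi d + a * x)"
    by (simp only: add_char_add add_char_power_CHAR_power)
qed simp

theorem theorem1p9:
  fixes d :: int and p n :: nat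
  assumes "CHAR('a::{finite,field}) = p"
    and "ext_degree TYPE('a) = n"
    and "even n"
    and "coprime d (int CARD('a) - 1)"
    and "\<exists>j::nat. [d = int p ^ j] (mod (int p ^ (n div 2) - 1))"
  shows "card ((weil_sum d :: 'a \<Rightarrow> complex) ` (UNIV - {0})) \<noteq> 3"
proof -
  define q where "q = p ^ (n div 2)"
  obtain j where j: "[d = int p ^ j] (mod (int q - 1))"
    using assms(5) by (auto simp: q_def)
  have card: "CARD('a) = p ^ n"
    using card_eq_CHAR_power_ext_degree[where 'a='a] assms(1,2) by simp
  have n: "n > 0" using ext_degree_pos[where 'a='a] assms(2) by simp
  have pn: "p ^ n = q ^ 2"
    using assms(3) by (simp add: q_def flip: power_mult)
  interpret square_order_field "TYPE('a)" "n div 2" q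
    by standard (simp_all add: card pn q_def assms(1))
  \<comment> \<open>Chosen so that \<open>j + k = n * j\<close>: then \<open>p ^ (j + k)\<close> is
    a power of \<open>p ^ n = q ^ 2\<close>, which is 1 modulo \<open>q - 1\<close>.\<close>
  define k where "k = (n - 1) * j"
  define e where "e = d * int (p ^ k)"
  have "[int q = 1] (mod (int q - 1))"
    by (simp add: cong_iff_dvd_diff)
  then have pn1: "[int p ^ n = 1] (mod (int q - 1))"
    using cong_pow[of "int q" 1 "int q - 1" 2] pn by (simp flip: of_nat_power)
  have "[e = int p ^ j * int p ^ k] (mod (int q - 1))"
    unfolding e_def of_nat_power by (rule cong_mult[OF j cong_refl])
  also have "int p ^ j * int p ^ k = (int p ^ n) ^ j"
  proof -
    have "j + k = n * j" using n by (cases n) (simp_all add: k_def)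
    then show ?thesis by (simp only: power_add[symmetric] power_mult[symmetric])
  qed
  also have "[\<dots> = 1] (mod (int q - 1))"
    using cong_pow[OF pn1, of j] by simp
  finally have e1: "[e = 1] (mod (int q - 1))" .
  have "coprime (int p ^ n) (int p ^ n - 1)"
    by (metis coprime_commute coprime_diff_one_left)
  then have "coprime (int p) (int CARD('a) - 1)"
    using n by (auto simp only: card of_nat_power coprime_power_left_iff)
  then have cop: "coprime e (int CARD('a) - 1)"
    using assms(4) by (simp add: e_def)
  \<comment> \<open>Zero is coprime only to units, whereas \<open>q ^ 2 - 1 \<ge> 3\<close>.\<close>
  have "e \<noteq> 0"
  proof
    assume "e = 0"
    then have "is_unit (int (q ^ 2) - 1)" using cop by (simp add: card_K)
    moreover have "int 4 \<le> int (q ^ 2)"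
      unfolding of_nat_le_iff using power_mono[OF q_ge_2, of 2] by simp
    ultimately show False by simp
  qed
  from card_weil_sum_image[OF this e1 cop]
  show ?thesis
    using weil_sum_mult_CHAR_power[of d k, where 'a='a] by (simp add: e_def assms(1) cong: image_cong)
qed

end
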